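(* There does not exist any linear function $f(r)$ such that for every $r\ge1$ and every $(\lambda,\mu,\nu)$ in the Hilbert basis of ${\sf LR}_r^{\mathbb Z}$, one has $\nu_1\le f(r)$.
   Context: For partitions $\lambda,\mu,\nu$ with at most $r$ nonzero parts, $c_{\lambda,\mu}^{\nu}$ denotes the Littlewood–Richardson coefficient (the multiplicity of the Schur function $s_\nu$ in $s_\lambda s_\mu$; equivalently the number of semistandard tableaux of skew shape $\nu/\lambda$ and content $\mu$ whose right-to-left, top-to-bottom row reading word is a ballot sequence). ${\sf LR}_r^{\mathbb Z}=\{(\lambda,\mu,\nu):c_{\lambda,\mu}^{\nu}>0\}\subset\mathbb{Z}^{3r}$; it is a finitely generated semigroup under componentwise addition, equal to the set of lattice points of a pointed rational polyhedral cone ${\sf LR}_r$. Its Hilbert basis is the set of nonzero elements of ${\sf LR}_r^{\mathbb Z}$ that are not the sum of two nonzero elements of ${\sf LR}_r^{\mathbb Z}$. *)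

theory Defs
  imports Complex_Main "HOL-Library.Function_Algebras" "HOL-Library.Product_Plus"
begin

text \<open>
  Rows, columns and tableau entries are all numbered from 0: the part \<open>\<lambda>\<^sub>i\<close> of the usual
  notation is \<open>l (i - 1)\<close>, and the usual tableau entry \<open>k\<close> is represented by \<open>k - 1\<close>.
\<close>

definition partitions :: "nat \<Rightarrow> (nat \<Rightarrow> nat) set" where
  "partitions r = {l. antimono l \<and> (\<forall>i\<ge>r. l i = 0)}"

definition skew_cells :: "(nat \<Rightarrow> nat) \<Rightarrow> (nat \<Rightarrow> nat) \<Rightarrow> (nat \<times> nat) set" where
  "skew_cells n l = {(i, j). l i \<le> j \<and> j < n i}"

text \<open>
  Fillings are total functions; the value 0 outside the shape makes the representation of a
  tableau unique, so that tableaux can be counted by \<open>card\<close>.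
\<close>

definition skew_ssyt :: "(nat \<Rightarrow> nat) \<Rightarrow> (nat \<Rightarrow> nat) \<Rightarrow> (nat \<Rightarrow> nat) \<Rightarrow> (nat \<Rightarrow> nat \<Rightarrow> nat) set" where
  "skew_ssyt n l m = {T.
     (\<forall>i j. (i, j) \<notin> skew_cells n l \<longrightarrow> T i j = 0) \<and>
     (\<forall>i j. (i, j) \<in> skew_cells n l \<and> (i, Suc j) \<in> skew_cells n l \<longrightarrow> T i j \<le> T i (Suc j)) \<and>
     (\<forall>i j. (i, j) \<in> skew_cells n l \<and> (Suc i, j) \<in> skew_cells n l \<longrightarrow> T i j < T (Suc i) j) \<and>
     (\<forall>k. card {(i, j). (i, j) \<in> skew_cells n l \<and> T i j = k} = m k)}"

definition reading_word ::
    "nat \<Rightarrow> (nat \<Rightarrow> nat) \<Rightarrow> (nat \<Rightarrow> nat) \<Rightarrow> (nat \<Rightarrow> nat \<Rightarrow> nat) \<Rightarrow> nat list" where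
  "reading_word r n l T = concat (map (\<lambda>i. rev (map (T i) [l i..<n i])) [0..<r])"

definition ballot :: "nat list \<Rightarrow> bool" where
  "ballot w \<longleftrightarrow> (\<forall>p k. count_list (take p w) (Suc k) \<le> count_list (take p w) k)"

text \<open>
  The coefficient \<open>c\<^bsub>l,m\<^esub>\<^bsup>n\<^esup>\<close> for \<open>l, m, n \<in> partitions r\<close>; the parameter \<open>r\<close> only bounds the number
  of rows to be read.
\<close>

definition lr_coeff ::
    "nat \<Rightarrow> (nat \<Rightarrow> nat) \<Rightarrow> (nat \<Rightarrow> nat) \<Rightarrow> (nat \<Rightarrow> nat) \<Rightarrow> nat" where
  "lr_coeff r l m n =
     (if \<forall>i. l i \<le> n i then card {T \<in> skew_ssyt n l m. ballot (reading_word r n l T)} else 0)"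

definition LR_semigroup :: "nat \<Rightarrow> ((nat \<Rightarrow> nat) \<times> (nat \<Rightarrow> nat) \<times> (nat \<Rightarrow> nat)) set" where
  "LR_semigroup r = {(l, m, n). l \<in> partitions r \<and> m \<in> partitions r \<and> n \<in> partitions r \<and>
                                lr_coeff r l m n > 0}"

definition hilbert_basis :: "'a::monoid_add set \<Rightarrow> 'a set" where
  "hilbert_basis S = {x \<in> S. x \<noteq> 0 \<and> \<not> (\<exists>y\<in>S. \<exists>z\<in>S. y \<noteq> 0 \<and> z \<noteq> 0 \<and> x = y + z)}"

text \<open>The sets counted by \<^const>\<open>lr_coeff\<close> are finite, so \<open>card\<close> is not degenerate there.\<close>

lemma finite_skew_ssyt:
  assumes m: "m \<in> partitions r" and n: "n \<in> partitions r"
  shows "finite (skew_ssyt n l m)"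
proof -
  have sub: "skew_cells n l \<subseteq> {..<r} \<times> {..<n 0}"
  proof
    fix c assume "c \<in> skew_cells n l"
    then obtain i j where c: "c = (i, j)" "j < n i" by (auto simp: skew_cells_def)
    have "i < r" using c n by (force simp: partitions_def not_le[symmetric])
    moreover have "n i \<le> n 0" using n by (auto simp: partitions_def antimono_def)
    ultimately show "c \<in> {..<r} \<times> {..<n 0}" using c by auto
  qed
  then have fin: "finite (skew_cells n l)" by (rule finite_subset) auto
  have bound: "T i j < r" if T: "T \<in> skew_ssyt n l m" and ij: "(i, j) \<in> skew_cells n l" for T i j
  proof (rule ccontr)
    let ?A = "{(i', j'). (i', j') \<in> skew_cells n l \<and> T i' j' = T i j}"
    assume "\<not> T i j < r"
    then have "m (T i j) = 0" using m by (auto simp: partitions_def)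
    then have "card ?A = 0" using T by (auto simp: skew_ssyt_def)
    moreover have "finite ?A" by (rule finite_subset[OF _ fin]) auto
    ultimately show False using ij by auto
  qed
  have "finite {f. \<forall>c. (c \<in> skew_cells n l \<longrightarrow> f c \<in> {..<r}) \<and> (c \<notin> skew_cells n l \<longrightarrow> f c = 0)}"
    using fin by (rule finite_set_of_finite_funs) auto
  then have "finite (curry ` {f. \<forall>c. (c \<in> skew_cells n l \<longrightarrow> f c \<in> {..<r}) \<and>
                                      (c \<notin> skew_cells n l \<longrightarrow> f c = (0::nat))})"
    by (rule finite_imageI)
  moreover have "skew_ssyt n l m \<subseteq> curry ` {f. \<forall>c. (c \<in> skew_cells n l \<longrightarrow> f c \<in> {..<r}) \<and>
                                      (c \<notin> skew_cells n l \<longrightarrow> f c = (0::nat))}"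
  proof
    fix T assume T: "T \<in> skew_ssyt n l m"
    have "T = curry (case_prod T)" by simp
    moreover have "case_prod T \<in> {f. \<forall>c. (c \<in> skew_cells n l \<longrightarrow> f c \<in> {..<r}) \<and>
                                      (c \<notin> skew_cells n l \<longrightarrow> f c = (0::nat))}"
      using T bound[OF T] by (auto simp: skew_ssyt_def)
    ultimately show "T \<in> curry ` {f. \<forall>c. (c \<in> skew_cells n l \<longrightarrow> f c \<in> {..<r}) \<and>
                                      (c \<notin> skew_cells n l \<longrightarrow> f c = (0::nat))}"
      by (rule image_eqI)
  qed
  ultimately show ?thesis by (rule finite_subset[rotated])
qed

end

theory Submission imports Defs "HOL-Library.Omega_Words_Fun"
begin

text \<open>
  Let \<open>x = (\<lambda>, \<mu>, \<nu>)\<close> be in the Hilbert basis of \<open>LR\<^bsub>r\<^esub>\<close> and \<open>y = \<nu>\<^sub>1\<close>. Then the triple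
  \<open>((y, y, \<lambda>), (y, y, \<mu>), (2y, y, y, \<nu>))\<close> is in the Hilbert basis of \<open>LR\<^bsub>r+3\<^esub>\<close>, so \<open>\<nu>\<^sub>1\<close> can be doubled
  at the cost of three rows. The reasons are that, for every \<open>y \<ge> \<nu>\<^sub>1\<close>, the Littlewood-Richardson
  tableaux of the prepended triple correspond to those of \<open>x\<close>, and that the prepended triples form a
  face of \<open>LR\<^bsub>r+3\<^esub>\<close>. Hence a decomposition of the prepended triple comes from decompositions
  \<open>\<nu>\<^sub>1 = y' + y''\<close> and \<open>x = x' + x''\<close>. As \<open>x\<close> is irreducible, say \<open>x' = 0\<close> and \<open>x'' = x\<close>; then
  \<open>y'' \<ge> \<nu>\<^sub>1\<close>, so \<open>y' = 0\<close> and the first summand vanishes.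
\<close>

subsection \<open>Ballot sequences\<close>

lemma ballot_append_left:
  assumes "ballot (w @ v)"
  shows "ballot w"
  unfolding ballot_def
proof (intro allI)
  fix p k
  have "take (min p (length w)) (w @ v) = take p w"
    by (simp add: min_def)
  then show "count_list (take p w) (Suc k) \<le> count_list (take p w) k"
    using assms unfolding ballot_def by metis
qed

lemma ballot_append_decreasing_count_le:
  assumes ballot: "ballot (w @ v)" and decreasing: "sorted (rev v)"
  shows "count_list w (Suc k) + count_list v (Suc k) \<le> count_list w k"
proof -
  define u where "u = takeWhile (\<lambda>x. k < x) v"
  have "take (length w + length u) (w @ v) = w @ u"
    by (simp add: u_def takeWhile_eq_take[symmetric])
  then have "count_list (w @ u) (Suc k) \<le> count_list (w @ u) k"
    using ballot unfolding ballot_def by metis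
  moreover have u: "u = filter (\<lambda>x. k < x) v"
    using decreasing filter_equals_takeWhile_sorted_rev[of "\<lambda>x. x" v k] by (simp add: u_def)
  moreover have "count_list u (Suc k) = count_list v (Suc k)"
    unfolding u count_list_eq_length_filter
    by (auto intro!: arg_cong[where f = length] filter_cong)
  ultimately show ?thesis by simp
qed

lemma ballot_appendI:
  assumes ballot: "ballot w"
    and le: "\<And>k. count_list w (Suc k) + count_list v (Suc k) \<le> count_list w k"
  shows "ballot (w @ v)"
  unfolding ballot_def
proof (intro allI)
  fix p k
  show "count_list (take p (w @ v)) (Suc k) \<le> count_list (take p (w @ v)) k"
  proof (cases "p \<le> length w")
    case True
    then show ?thesis using ballot by (simp add: ballot_def)
  next
    case False
    define u where "u = take (p - length w) v"
    have "count_list u (Suc k) \<le> count_list v (Suc k)"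
      unfolding u_def by (metis append_take_drop_id count_list_append le_add1)
    then have "count_list (w @ u) (Suc k) \<le> count_list w k"
      using le[of k] by simp
    with False show ?thesis by (simp add: u_def)
  qed
qed

lemma ballot_append_iff:
  assumes "sorted (rev v)"
  shows "ballot (w @ v) \<longleftrightarrow>
     ballot w \<and> (\<forall>k. count_list w (Suc k) + count_list v (Suc k) \<le> count_list w k)"
  using assms ballot_append_left ballot_append_decreasing_count_le ballot_appendI by blast

lemma card_less_eq_sum_card_eq:
  fixes f :: "'a \<Rightarrow> nat"
  assumes "finite A"
  shows "card {x \<in> A. f x < k} = (\<Sum>k'<k. card {x \<in> A. f x = k'})"
proof (induction k)
  case (Suc k)
  have "{x \<in> A. f x < Suc k} = {x \<in> A. f x < k} \<union> {x \<in> A. f x = k}" by auto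
  moreover have "card \<dots> = card {x \<in> A. f x < k} + card {x \<in> A. f x = k}"
    using assms by (intro card_Un_disjoint) auto
  ultimately show ?case using Suc by simp
qed simp

lemma initial_segment_eq_atLeastLessThan_card:
  fixes p q :: nat
  assumes "A \<subseteq> {p..<q}" and closed: "\<And>x y. y \<in> A \<Longrightarrow> p \<le> x \<Longrightarrow> x \<le> y \<Longrightarrow> x \<in> A"
  shows "A = {p..<p + card A}"
proof (cases "A = {}")
  case False
  have fin: "finite A" using assms(1) finite_subset by blast
  have "A = {p..<Suc (Max A)}"
    using assms(1) closed[OF Max_in[OF fin False]] Max_ge[OF fin] by (auto simp: less_Suc_eq_le)
  moreover from this have "card A = Suc (Max A) - p" by (metis card_atLeastLessThan)
  moreover have "p \<le> Max A" using Max_in[OF fin False] assms(1) by auto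
  ultimately show ?thesis by simp
qed simp

subsection \<open>Row contents of skew tableaux\<close>

definition row_content ::
    "(nat \<Rightarrow> nat) \<Rightarrow> (nat \<Rightarrow> nat) \<Rightarrow> (nat \<Rightarrow> nat \<Rightarrow> nat) \<Rightarrow> nat \<Rightarrow> nat \<Rightarrow> nat" where
  "row_content n l T i k = card {j \<in> {l i..<n i}. T i j = k}"

lemma count_list_reading_word:
  "count_list (reading_word r n l T) k = (\<Sum>i<r. row_content n l T i k)"
proof (induction r)
  case (Suc r)
  have "count_list (map (T r) [l r..<n r]) k = length (filter (\<lambda>j. T r j = k) [l r..<n r])"
    by (simp add: count_list_eq_length_filter filter_map comp_def eq_commute)
  also have "\<dots> = card ({j. T r j = k} \<inter> set [l r..<n r])"
    by (rule distinct_length_filter) simp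
  also have "\<dots> = row_content n l T r k"
    unfolding row_content_def by (rule arg_cong[where f = card]) auto
  finally show ?case using Suc by (simp add: reading_word_def)
qed (simp add: reading_word_def)

lemma ballot_reading_word_iff:
  assumes mono: "\<And>i j j'. l i \<le> j \<Longrightarrow> j \<le> j' \<Longrightarrow> j' < n i \<Longrightarrow> T i j \<le> T i j'"
  shows "ballot (reading_word r n l T) \<longleftrightarrow>
     (\<forall>i<r. \<forall>k. (\<Sum>i'<Suc i. row_content n l T i' (Suc k)) \<le> (\<Sum>i'<i. row_content n l T i' k))"
proof (induction r)
  case 0
  then show ?case by (simp add: reading_word_def ballot_def)
next
  case (Suc r)
  let ?row = "rev (map (T r) [l r..<n r])"
  have snoc: "reading_word (Suc r) n l T = reading_word r n l T @ ?row"
    by (simp add: reading_word_def)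
  have "sorted (rev ?row)"
    using mono by (auto simp: sorted_iff_nth_mono_less)
  moreover have "count_list (reading_word r n l T) (Suc k) + count_list ?row (Suc k) =
      (\<Sum>i<Suc r. row_content n l T i (Suc k))" for k
    using count_list_reading_word[of "Suc r" n l T "Suc k"] unfolding snoc by simp
  ultimately have "ballot (reading_word (Suc r) n l T) \<longleftrightarrow> ballot (reading_word r n l T) \<and>
      (\<forall>k. (\<Sum>i'<Suc r. row_content n l T i' (Suc k)) \<le> (\<Sum>i'<r. row_content n l T i' k))"
    unfolding snoc by (simp only: ballot_append_iff count_list_reading_word)
  then show ?case
    unfolding Suc.IH less_Suc_eq by blast
qed

lemma reading_word_eq_if_length_le:
  assumes "\<And>i. r \<le> i \<Longrightarrow> n i = 0" and "r \<le> s"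
  shows "reading_word s n l T = reading_word r n l T"
  using assms(2)
proof (induction s rule: dec_induct)
  case (step s)
  then show ?case using assms(1)[of s] by (simp add: reading_word_def)
qed simp

lemma card_skew_cells_entry:
  assumes "\<And>i. r \<le> i \<Longrightarrow> n i = 0"
  shows "card {(i, j). (i, j) \<in> skew_cells n l \<and> T i j = k} = (\<Sum>i<r. row_content n l T i k)"
proof -
  have "{(i, j). (i, j) \<in> skew_cells n l \<and> T i j = k} = (SIGMA i:{..<r}. {j \<in> {l i..<n i}. T i j = k})"
    using assms by (auto simp: skew_cells_def) (metis not_le not_less0)
  then show ?thesis by (simp add: row_content_def)
qed

lemma skew_ssyt_row_mono:
  assumes T: "T \<in> skew_ssyt n l m" and "l i \<le> j" "j \<le> j'" "j' < n i"
  shows "T i j \<le> T i j'"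
  using assms(3,4)
proof (induction j' rule: dec_induct)
  case (step j')
  have "T i j' \<le> T i (Suc j')"
    using T step \<open>l i \<le> j\<close> by (auto simp: skew_ssyt_def skew_cells_def)
  with step show ?case by simp
qed simp

definition subshape :: "(nat \<Rightarrow> nat) \<Rightarrow> (nat \<Rightarrow> nat \<Rightarrow> nat) \<Rightarrow> nat \<Rightarrow> nat \<Rightarrow> nat" where
  "subshape l a k i = l i + (\<Sum>k'<k. a i k')"

lemma subshape_0 [simp]: "subshape l a 0 i = l i"
  by (simp add: subshape_def)

lemma subshape_Suc [simp]: "subshape l a (Suc k) i = subshape l a k i + a i k"
  by (simp add: subshape_def)

lemma subshape_mono: "k \<le> k' \<Longrightarrow> subshape l a k i \<le> subshape l a k' i"
  by (rule lift_Suc_mono_le[where f = "\<lambda>k. subshape l a k i"]) simp_all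

lemma subshape_row_content:
  "subshape l (row_content n l T) k i = l i + card {j \<in> {l i..<n i}. T i j < k}"
  unfolding subshape_def row_content_def by (subst card_less_eq_sum_card_eq) simp_all

lemma skew_ssyt_entry_less_iff:
  assumes T: "T \<in> skew_ssyt n l m" and j: "l i \<le> j" "j < n i"
  shows "T i j < k \<longleftrightarrow> j < subshape l (row_content n l T) k i"
proof -
  let ?A = "{j \<in> {l i..<n i}. T i j < k}"
  have "?A = {l i..<l i + card ?A}"
  proof (rule initial_segment_eq_atLeastLessThan_card)
    fix j j' assume "j' \<in> ?A" "l i \<le> j" "j \<le> j'"
    then show "j \<in> ?A" using skew_ssyt_row_mono[OF T, of i j j'] by auto
  qed auto
  then have "j \<in> ?A \<longleftrightarrow> j \<in> {l i..<l i + card ?A}" by (rule arg_cong)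
  with j show ?thesis unfolding subshape_row_content by simp
qed

lemma row_content_eqI:
  assumes "subshape l a (Suc k) i \<le> n i"
    and entries: "\<And>j k. l i \<le> j \<Longrightarrow> j < n i \<Longrightarrow> T i j < k \<longleftrightarrow> j < subshape l a k i"
  shows "row_content n l T i k = a i k"
proof -
  have "{j \<in> {l i..<n i}. T i j = k} = {subshape l a k i..<subshape l a (Suc k) i}"
  proof (intro set_eqI)
    fix j
    have "l i \<le> subshape l a k i" by (simp add: subshape_def)
    moreover have "T i j = k \<longleftrightarrow> T i j < Suc k \<and> \<not> T i j < k" by auto
    ultimately show "j \<in> {j \<in> {l i..<n i}. T i j = k} \<longleftrightarrow>
        j \<in> {subshape l a k i..<subshape l a (Suc k) i}"
      using assms(1) entries[of j k] entries[of j "Suc k"] by (auto simp del: subshape_Suc)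
  qed
  then show ?thesis by (simp add: row_content_def)
qed

subsection \<open>Littlewood-Richardson triangles\<close>

lemma ballot_rows_below_diagonal:
  fixes a :: "nat \<Rightarrow> nat \<Rightarrow> nat"
  assumes ballot: "\<And>i k. (\<Sum>i'<Suc i. a i' (Suc k)) \<le> (\<Sum>i'<i. a i' k)" and "i < k"
  shows "a i k = 0"
  using \<open>i < k\<close>
proof (induction k arbitrary: i)
  case (Suc k)
  have "a i (Suc k) \<le> (\<Sum>i'<Suc i. a i' (Suc k))" by simp
  also have "\<dots> \<le> (\<Sum>i'<i. a i' k)" by (rule ballot)
  also have "\<dots> = 0" using Suc by simp
  finally show ?case by simp
qed simp

text \<open>
  The encoding of a Littlewood-Richardson tableau by the numbers \<open>a i k\<close> of entries \<open>k\<close> in row \<open>i\<close>.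
  The entries less than \<open>k\<close> together with the inner shape form the partition \<open>subshape l a k\<close>;
  columns increase strictly iff consecutive partitions of this kind differ by horizontal strips.
\<close>

locale lr_triangle =
  fixes r :: nat and l m n :: "nat \<Rightarrow> nat" and a :: "nat \<Rightarrow> nat \<Rightarrow> nat"
  assumes length_le: "r \<le> i \<Longrightarrow> n i = 0"
    and row_end: "subshape l a (Suc i) i = n i"
    and horizontal_strip: "subshape l a (Suc k) (Suc i) \<le> subshape l a k i"
    and column_sum: "(\<Sum>i<r. a i k) = m k"
    and ballot_rows: "(\<Sum>i'<Suc i. a i' (Suc k)) \<le> (\<Sum>i'<i. a i' k)"
begin

lemma below_diagonal: "i < k \<Longrightarrow> a i k = 0"
  using ballot_rows by (rule ballot_rows_below_diagonal)

lemma subshape_eq_outer: "Suc i \<le> k \<Longrightarrow> subshape l a k i = n i"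
  by (induction k rule: dec_induct) (use row_end below_diagonal in simp_all)

lemma subshape_le_outer: "subshape l a k i \<le> n i"
  using subshape_mono[of k "max k (Suc i)" l a i] subshape_eq_outer[of i "max k (Suc i)"] by simp

lemma inner_le: "l i \<le> n i"
  using subshape_le_outer[of 0] by simp

lemma beyond_length: "r \<le> i \<Longrightarrow> a i k = 0"
  using subshape_le_outer[of "Suc k" i] length_le[of i] by simp

lemma column_sum_eq_content: "r \<le> N \<Longrightarrow> (\<Sum>i<N. a i k) = m k"
  unfolding column_sum[symmetric] by (rule sum.mono_neutral_right) (auto simp: beyond_length)

lemma inner_Suc_le: "l (Suc i) \<le> l i"
  using horizontal_strip[of 0 i] by simp

lemma partitions_inner: "l \<in> partitions r"
proof -
  have "l i = 0" if "r \<le> i" for i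
    using inner_le[of i] length_le[OF that] by simp
  then show ?thesis by (simp add: partitions_def antimono_iff_le_Suc inner_Suc_le)
qed

lemma partitions_content: "m \<in> partitions r"
proof -
  have "m (Suc k) \<le> m k" for k
    using ballot_rows[of k r] column_sum[of k] column_sum_eq_content[of "Suc r" "Suc k"] by simp
  moreover have "m k = 0" if "r \<le> k" for k
    using that by (simp flip: column_sum add: below_diagonal)
  ultimately show ?thesis by (simp add: partitions_def antimono_iff_le_Suc)
qed

lemma partitions_outer: "n \<in> partitions r"
proof -
  have "n (Suc i) \<le> n i" for i
    using horizontal_strip[of "Suc i" i] row_end[of i] row_end[of "Suc i"] by simp
  then show ?thesis using length_le by (simp add: partitions_def antimono_iff_le_Suc)
qed

lemma first_part_le: "n 0 \<le> l 0 + m 0"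
proof -
  have "a 0 0 \<le> (\<Sum>i<Suc r. a i 0)"
    by (rule member_le_sum) auto
  then show ?thesis
    using row_end[of 0] column_sum_eq_content[of "Suc r" 0] by simp
qed

lemma antimono_column_sum_add_subshape:
  "antimono (\<lambda>N. (\<Sum>i<N. a i k) + subshape l a (Suc k) N)"
  unfolding antimono_iff_le_Suc using horizontal_strip[of k] by (simp add: add.assoc)

lemma column_sum_add_subshape_le:
  assumes "k \<le> N"
  shows "(\<Sum>i<N. a i k) + subshape l a (Suc k) N \<le> n k"
proof -
  have "(\<Sum>i<N. a i k) + subshape l a (Suc k) N \<le> (\<Sum>i<k. a i k) + subshape l a (Suc k) k"
    by (rule antimonoD[OF antimono_column_sum_add_subshape assms])
  then show ?thesis
    using row_end[of k] below_diagonal by simp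
qed

lemma content_le: "m k \<le> n k"
  using column_sum_add_subshape_le[of k "max k r"] column_sum_eq_content[of "max k r" k] by simp

lemma column_sum_add_subshape_eq:
  assumes "m k = n k" and "k \<le> N"
  shows "(\<Sum>i<N. a i k) + subshape l a (Suc k) N = n k"
proof (rule antisym[OF column_sum_add_subshape_le[OF assms(2)]])
  have "n k \<le> (\<Sum>i<max N r. a i k) + subshape l a (Suc k) (max N r)"
    using column_sum_eq_content[of "max N r" k] assms(1) by simp
  also have "\<dots> \<le> (\<Sum>i<N. a i k) + subshape l a (Suc k) N"
    by (rule antimonoD[OF antimono_column_sum_add_subshape]) simp
  finally show "n k \<le> (\<Sum>i<N. a i k) + subshape l a (Suc k) N" .
qed

lemma entry_eq_0_if_subshape_eq_outer:
  assumes "subshape l a k i = n i" and "k \<le> k'"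
  shows "a i k' = 0"
  using subshape_le_outer[of "Suc k'" i] subshape_mono[OF assms(2), of l a i] assms(1) by simp

lemma entry_0_eq_0_if_corner_eq_content:
  assumes "a 0 0 = m 0"
  shows "a (Suc i) 0 = 0"
proof -
  have "(\<Sum>i'<Suc (r + Suc i). a i' 0) = m 0"
    by (rule column_sum_eq_content) simp
  then have "(\<Sum>i'<r + Suc i. a (Suc i') 0) = 0"
    unfolding sum.lessThan_Suc_shift assms by simp
  moreover have "a (Suc i) 0 \<le> (\<Sum>i'<r + Suc i. a (Suc i') 0)"
    by (rule member_le_sum) auto
  ultimately show ?thesis by simp
qed

definition tableau :: "nat \<Rightarrow> nat \<Rightarrow> nat" where
  "tableau i j = (if (i, j) \<in> skew_cells n l then LEAST k. j < subshape l a (Suc k) i else 0)"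

lemma tableau_less_iff:
  assumes "l i \<le> j" and "j < n i"
  shows "tableau i j < k \<longleftrightarrow> j < subshape l a k i"
proof (cases k)
  case 0
  then show ?thesis using assms(1) by simp
next
  case (Suc k')
  have T: "tableau i j = (LEAST k. j < subshape l a (Suc k) i)"
    using assms by (simp add: tableau_def skew_cells_def)
  have "tableau i j \<le> k' \<longleftrightarrow> j < subshape l a (Suc k') i"
  proof
    have "j < subshape l a (Suc (tableau i j)) i"
      unfolding T using assms(2) row_end[of i] by (metis LeastI)
    also assume "tableau i j \<le> k'"
    then have "subshape l a (Suc (tableau i j)) i \<le> subshape l a (Suc k') i"
      by (intro subshape_mono) simp
    finally show "j < subshape l a (Suc k') i" .
  next
    assume "j < subshape l a (Suc k') i"
    then show "tableau i j \<le> k'" unfolding T by (rule Least_le)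
  qed
  with Suc show ?thesis by (simp add: less_Suc_eq_le)
qed

lemma row_content_tableau: "row_content n l tableau i k = a i k"
  by (rule row_content_eqI) (simp_all only: subshape_le_outer tableau_less_iff)

lemma tableau_row_mono:
  assumes "l i \<le> j" "j \<le> j'" "j' < n i"
  shows "tableau i j \<le> tableau i j'"
  using tableau_less_iff[of i j "Suc (tableau i j')"] tableau_less_iff[of i j' "Suc (tableau i j')"] assms
  by (simp del: subshape_Suc)

lemma tableau_mem_skew_ssyt: "tableau \<in> skew_ssyt n l m"
proof -
  have "tableau i j < tableau (Suc i) j"
    if "(i, j) \<in> skew_cells n l" "(Suc i, j) \<in> skew_cells n l" for i j
  proof -
    define k where "k = tableau (Suc i) j"
    have "j < subshape l a (Suc k) (Suc i)"
      using that(2) tableau_less_iff[of "Suc i" j "Suc k"] by (simp add: skew_cells_def k_def)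
    also have "\<dots> \<le> subshape l a k i" by (rule horizontal_strip)
    finally show ?thesis
      using that(1) tableau_less_iff[of i j k] by (simp add: skew_cells_def k_def)
  qed
  moreover have "card {(i, j). (i, j) \<in> skew_cells n l \<and> tableau i j = k} = m k" for k
    by (simp add: card_skew_cells_entry[of r] length_le row_content_tableau column_sum)
  ultimately show ?thesis
    using tableau_row_mono by (auto simp: skew_ssyt_def skew_cells_def tableau_def)
qed

lemma ballot_tableau: "ballot (reading_word r n l tableau)"
proof -
  have "ballot (reading_word r n l tableau) \<longleftrightarrow>
      (\<forall>i<r. \<forall>k. (\<Sum>i'<Suc i. a i' (Suc k)) \<le> (\<Sum>i'<i. a i' k))"
    by (subst ballot_reading_word_iff) (simp_all only: tableau_row_mono row_content_tableau)
  then show ?thesis using ballot_rows by blast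
qed

end

lemma skew_ssyt_horizontal_strip:
  assumes T: "T \<in> skew_ssyt n l m" and "antimono l" "antimono n" and le: "\<And>i. l i \<le> n i"
  shows "subshape l (row_content n l T) (Suc k) (Suc i) \<le> subshape l (row_content n l T) k i"
proof (rule ccontr)
  let ?s = "subshape l (row_content n l T)"
  assume "\<not> ?s (Suc k) (Suc i) \<le> ?s k i"
  then have below: "?s k i < ?s (Suc k) (Suc i)" by simp
  have "card {j \<in> {l (Suc i)..<n (Suc i)}. T (Suc i) j < Suc k} \<le> card {l (Suc i)..<n (Suc i)}"
    by (intro card_mono) auto
  then have "?s (Suc k) (Suc i) \<le> n (Suc i)"
    using le[of "Suc i"] by (simp add: subshape_row_content del: subshape_Suc)
  moreover have "l i \<le> ?s k i" by (simp add: subshape_def)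
  ultimately have cells: "(i, ?s k i) \<in> skew_cells n l" "(Suc i, ?s k i) \<in> skew_cells n l"
    using below antimonoD[OF \<open>antimono l\<close>, of i "Suc i"] antimonoD[OF \<open>antimono n\<close>, of i "Suc i"]
    by (auto simp: skew_cells_def simp del: subshape_Suc)
  then have "T i (?s k i) < T (Suc i) (?s k i)"
    using T by (simp add: skew_ssyt_def)
  moreover have "T (Suc i) (?s k i) < Suc k"
    using cells(2) below skew_ssyt_entry_less_iff[OF T, of "Suc i" "?s k i" "Suc k"]
    by (simp only: skew_cells_def mem_Collect_eq prod.case)
  moreover have "\<not> T i (?s k i) < k"
    using cells(1) skew_ssyt_entry_less_iff[OF T, of i "?s k i" k] by (simp add: skew_cells_def)
  ultimately show False by simp
qed

lemma lr_triangle_row_content: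
  assumes l: "l \<in> partitions r" and n: "n \<in> partitions r" and le: "\<And>i. l i \<le> n i"
    and T: "T \<in> skew_ssyt n l m" and ballot: "ballot (reading_word r n l T)"
  shows "lr_triangle r l m n (row_content n l T)"
proof
  let ?a = "row_content n l T"
  show length_le: "n i = 0" if "r \<le> i" for i
    using n that by (simp add: partitions_def)
  show "(\<Sum>i<r. ?a i k) = m k" for k
    using T card_skew_cells_entry[of r n l T k] length_le by (simp add: skew_ssyt_def)
  show "subshape l ?a (Suc k) (Suc i) \<le> subshape l ?a k i" for k i
    by (rule skew_ssyt_horizontal_strip[OF T]) (use l n le in \<open>auto simp: partitions_def\<close>)
  show ballot_rows: "(\<Sum>i'<Suc i. ?a i' (Suc k)) \<le> (\<Sum>i'<i. ?a i' k)" for i k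
  proof -
    have "ballot (reading_word (r + Suc i) n l T)"
      using ballot reading_word_eq_if_length_le[of r n "r + Suc i"] length_le by simp
    then have "\<forall>i'<r + Suc i. \<forall>k. (\<Sum>i''<Suc i'. ?a i'' (Suc k)) \<le> (\<Sum>i''<i'. ?a i'' k)"
      by (subst (asm) ballot_reading_word_iff) (use skew_ssyt_row_mono[OF T] in auto)
    then show ?thesis by simp
  qed
  show "subshape l ?a (Suc i) i = n i" for i
  proof -
    have "T i j < Suc i" if j: "j \<in> {l i..<n i}" for j
    proof (rule ccontr)
      assume "\<not> T i j < Suc i"
      then have "?a i (T i j) = 0"
        by (intro ballot_rows_below_diagonal[of ?a] ballot_rows) simp
      then show False using j by (auto simp: row_content_def)
    qed
    then have "{j \<in> {l i..<n i}. T i j < Suc i} = {l i..<n i}" by blast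
    then show ?thesis using le[of i] by (simp add: subshape_row_content del: subshape_Suc)
  qed
qed

lemma mem_LR_semigroup_iff:
  "(l, m, n) \<in> LR_semigroup r \<longleftrightarrow> (\<exists>a. lr_triangle r l m n a)"
proof -
  have "finite {T \<in> skew_ssyt n l m. ballot (reading_word r n l T)}"
    if "m \<in> partitions r" "n \<in> partitions r"
    using finite_skew_ssyt[OF that] by simp
  then have "(l, m, n) \<in> LR_semigroup r \<longleftrightarrow>
      l \<in> partitions r \<and> m \<in> partitions r \<and> n \<in> partitions r \<and> (\<forall>i. l i \<le> n i) \<and>
      (\<exists>T\<in>skew_ssyt n l m. ballot (reading_word r n l T))"
    by (auto simp: LR_semigroup_def lr_coeff_def card_gt_0_iff split: if_splits)
  also have "\<dots> \<longleftrightarrow> (\<exists>a. lr_triangle r l m n a)"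
    using lr_triangle_row_content lr_triangle.partitions_inner lr_triangle.partitions_content
      lr_triangle.partitions_outer lr_triangle.inner_le lr_triangle.tableau_mem_skew_ssyt
      lr_triangle.ballot_tableau by meson
  finally show ?thesis .
qed

subsection \<open>Doubling the first part\<close>

lemma nat_cases_Suc2 [case_names 0 1 Suc2]:
  obtains "k = 0" | "k = Suc 0" | k' where "k = Suc (Suc k')"
  by (metis not0_implies_Suc)

lemma nat_cases_Suc3 [case_names 0 1 2 Suc3]:
  obtains "i = 0" | "i = Suc 0" | "i = Suc (Suc 0)" | i' where "i = Suc (Suc (Suc i'))"
  by (metis not0_implies_Suc)

fun prepend :: "nat \<Rightarrow> (nat \<Rightarrow> nat) \<times> (nat \<Rightarrow> nat) \<times> (nat \<Rightarrow> nat) \<Rightarrow>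
    (nat \<Rightarrow> nat) \<times> (nat \<Rightarrow> nat) \<times> (nat \<Rightarrow> nat)" where
  "prepend y (l, m, n) = (y ## y ## l, y ## y ## m, 2 * y ## y ## y ## n)"

text \<open>
  Row 0 receives \<open>y\<close> entries 0, each column \<open>j < y\<close> of the shape below receives an entry 1 at its top
  (in row \<open>i + 3\<close> iff \<open>l (Suc i) \<le> j < l i\<close>), and the old entries are raised by 2.
\<close>

definition prepend_triangle ::
    "nat \<Rightarrow> (nat \<Rightarrow> nat) \<Rightarrow> (nat \<Rightarrow> nat \<Rightarrow> nat) \<Rightarrow> nat \<Rightarrow> nat \<Rightarrow> nat" where
  "prepend_triangle y l a =
     (y ## 0) ## 0 ## (0 ## (y - l 0) ## 0) ## (\<lambda>i. 0 ## (l i - l (Suc i)) ## a i)"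

lemma prepend_triangle_simps [simp]:
  "prepend_triangle y l a 0 0 = y"
  "prepend_triangle y l a 0 (Suc k) = 0"
  "prepend_triangle y l a (Suc 0) k = 0"
  "prepend_triangle y l a (Suc (Suc i)) 0 = 0"
  "prepend_triangle y l a (Suc (Suc 0)) (Suc 0) = y - l 0"
  "prepend_triangle y l a (Suc (Suc 0)) (Suc (Suc k)) = 0"
  "prepend_triangle y l a (Suc (Suc (Suc i))) (Suc 0) = l i - l (Suc i)"
  "prepend_triangle y l a (Suc (Suc (Suc i))) (Suc (Suc k)) = a i k"
  by (cases i; simp add: prepend_triangle_def)+

lemma subshape_prepend_triangle:
  "subshape (y ## y ## l) (prepend_triangle y l a) (Suc k) 0 = 2 * y"
  "subshape (y ## y ## l) (prepend_triangle y l a) k (Suc 0) = y"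
  "subshape (y ## y ## l) (prepend_triangle y l a) (Suc 0) (Suc (Suc i)) = l i"
  "l 0 \<le> y \<Longrightarrow> subshape (y ## y ## l) (prepend_triangle y l a) (Suc (Suc k)) (Suc (Suc 0)) = y"
  "l (Suc i) \<le> l i \<Longrightarrow>
     subshape (y ## y ## l) (prepend_triangle y l a) (Suc (Suc k)) (Suc (Suc (Suc i))) = subshape l a k i"
  by (induction k) simp_all

context lr_triangle
begin

context
  fixes y :: nat
  assumes outer_first_le: "n 0 \<le> y"
begin

lemma inner_first_le: "l 0 \<le> y"
  using inner_le[of 0] outer_first_le by simp

lemma column_sums_prepend_triangle:
  "(\<Sum>i<Suc (Suc (Suc N)). prepend_triangle y l a i 0) = y"
  "(\<Sum>i<Suc (Suc (Suc N)). prepend_triangle y l a i (Suc 0)) + l N = y"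
  "(\<Sum>i<Suc (Suc (Suc N)). prepend_triangle y l a i (Suc (Suc k))) = (\<Sum>i<N. a i k)"
proof -
  show "(\<Sum>i<Suc (Suc (Suc N)). prepend_triangle y l a i 0) = y"
    by (induction N) simp_all
  show "(\<Sum>i<Suc (Suc (Suc N)). prepend_triangle y l a i (Suc 0)) + l N = y"
  proof (induction N)
    case (Suc N)
    then show ?case using inner_Suc_le[of N] by simp
  qed (simp add: inner_first_le)
  show "(\<Sum>i<Suc (Suc (Suc N)). prepend_triangle y l a i (Suc (Suc k))) = (\<Sum>i<N. a i k)"
    by (induction N) simp_all
qed

lemma horizontal_strip_prepend_triangle:
  "subshape (y ## y ## l) (prepend_triangle y l a) (Suc k) (Suc i)
     \<le> subshape (y ## y ## l) (prepend_triangle y l a) k i"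
  using outer_first_le horizontal_strip
  by (cases k rule: nat_cases_Suc2; cases i rule: nat_cases_Suc3)
    (simp_all add: subshape_prepend_triangle subshape_eq_outer inner_first_le inner_Suc_le
      del: subshape_Suc)

lemma ballot_rows_prepend_triangle:
  "(\<Sum>i'<Suc i. prepend_triangle y l a i' (Suc k)) \<le> (\<Sum>i'<i. prepend_triangle y l a i' k)"
proof (cases i rule: nat_cases_Suc3)
  case (Suc3 j)
  show ?thesis
  proof (cases k rule: nat_cases_Suc2)
    case 0
    then show ?thesis
      using column_sums_prepend_triangle(1)[of j] column_sums_prepend_triangle(2)[of "Suc j"] Suc3
      by (simp del: sum.lessThan_Suc)
  next
    case 1
    have "(\<Sum>i<Suc j. a i 0) + l j \<le> y"
      using column_sum_add_subshape_le[of 0 j] outer_first_le by simp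
    then show ?thesis
      using column_sums_prepend_triangle(3)[where N = "Suc j" and k = 0]
        column_sums_prepend_triangle(2)[of j] 1 Suc3
      by (simp del: sum.lessThan_Suc)
  next
    case (Suc2 k')
    then show ?thesis
      using ballot_rows[where i = j and k = k'] Suc3 by (simp only: column_sums_prepend_triangle(3))
  qed
qed (cases k; simp)+

lemma lr_triangle_prepend:
  "lr_triangle (r + 3) (y ## y ## l) (y ## y ## m) (2 * y ## y ## y ## n) (prepend_triangle y l a)"
proof
  show "(2 * y ## y ## y ## n) i = 0" if "r + 3 \<le> i" for i
    using that length_le by (cases i rule: nat_cases_Suc3) simp_all
  show "subshape (y ## y ## l) (prepend_triangle y l a) (Suc i) i = (2 * y ## y ## y ## n) i" for i
    by (cases i rule: nat_cases_Suc3)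
      (simp_all add: subshape_prepend_triangle subshape_eq_outer inner_first_le inner_Suc_le
        del: subshape_Suc)
  show "(\<Sum>i<r + 3. prepend_triangle y l a i k) = (y ## y ## m) k" for k
  proof -
    have "l r = 0" using partitions_inner by (simp add: partitions_def)
    then show ?thesis
      using column_sums_prepend_triangle(1,2)[of r] column_sums_prepend_triangle(3) column_sum
      by (cases k rule: nat_cases_Suc2) (simp_all add: numeral_3_eq_3 del: sum.lessThan_Suc)
  qed
qed (rule horizontal_strip_prepend_triangle ballot_rows_prepend_triangle)+

end

end

lemma lr_triangle_prependD:
  assumes "lr_triangle (r + 3) (y ## y ## l) (y ## y ## m) (2 * y ## y ## y ## n) a"
  shows "lr_triangle r l m n (\<lambda>i k. a (Suc (Suc (Suc i))) (Suc (Suc k)))"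
proof -
  let ?L = "y ## y ## l" and ?N = "2 * y ## y ## y ## n"
  let ?a = "\<lambda>i k. a (Suc (Suc (Suc i))) (Suc (Suc k))"
  interpret T: lr_triangle "r + 3" ?L "y ## y ## m" ?N a by fact
  have entry_0: "a (Suc i) 0 = 0" for i
    using T.row_end[of 0] by (intro T.entry_0_eq_0_if_corner_eq_content) simp
  text \<open>
    Since \<open>\<mu>\<^sub>2 = \<nu>\<^sub>2 = y\<close>, every column \<open>j < y\<close> contains an entry 1, and the entries 0 are all in
    row 0; hence that entry 1 is at the top of its column.
  \<close>
  have subshape_2: "subshape ?L a (Suc (Suc 0)) (Suc (Suc i)) = ?L (Suc i)" for i
    using T.column_sum_add_subshape_eq[of 1 "Suc i"] T.column_sum_add_subshape_eq[of 1 "Suc (Suc i)"]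
    by (simp add: entry_0)
  have row_1: "a (Suc 0) k = 0" for k
    by (rule T.entry_eq_0_if_subshape_eq_outer[of 0]) simp_all
  have row_2: "a (Suc (Suc 0)) (Suc (Suc k)) = 0" for k
    by (rule T.entry_eq_0_if_subshape_eq_outer[of "Suc (Suc 0)"])
      (simp_all add: subshape_2 del: subshape_Suc)
  have subshape: "subshape l ?a k i = subshape ?L a (Suc (Suc k)) (Suc (Suc (Suc i)))" for k i
    using subshape_2[of "Suc i"] by (induction k) simp_all
  have column: "(\<Sum>i<N. ?a i k) = (\<Sum>i<Suc (Suc (Suc N)). a i (Suc (Suc k)))" for N k
    using T.below_diagonal[of 0 "Suc (Suc k)"] row_1 row_2 by (induction N) simp_all
  have ballot_rows: "(\<Sum>i'<Suc i. ?a i' (Suc k)) \<le> (\<Sum>i'<i. ?a i' k)" for i k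
    unfolding column by (rule T.ballot_rows)
  show ?thesis
  proof
    show "n i = 0" if "r \<le> i" for i
      using T.length_le[of "Suc (Suc (Suc i))"] that by simp
    show "subshape l ?a (Suc i) i = n i" for i
      using T.row_end[of "Suc (Suc (Suc i))"] ballot_rows_below_diagonal[of ?a, OF ballot_rows]
      by (simp add: subshape)
    show "subshape l ?a (Suc k) (Suc i) \<le> subshape l ?a k i" for k i
      unfolding subshape by (rule T.horizontal_strip)
    show "(\<Sum>i<r. ?a i k) = m k" for k
      unfolding column using T.column_sum[of "Suc (Suc k)"]
      by (simp add: numeral_3_eq_3 del: sum.lessThan_Suc)
  qed (rule ballot_rows)
qed

lemma LR_semigroup_antimono:
  assumes "(l, m, n) \<in> LR_semigroup r"
  shows "antimono l" "antimono m" "antimono n"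
  using assms by (simp_all add: LR_semigroup_def partitions_def)

lemma LR_semigroup_inner_le:
  assumes "(l, m, n) \<in> LR_semigroup r"
  shows "l i \<le> n i"
  using assms mem_LR_semigroup_iff lr_triangle.inner_le by blast

lemma LR_semigroup_content_le:
  assumes "(l, m, n) \<in> LR_semigroup r"
  shows "m i \<le> n i"
  using assms mem_LR_semigroup_iff lr_triangle.content_le by blast

lemma LR_semigroup_first_part_le:
  assumes "(l, m, n) \<in> LR_semigroup r"
  shows "n 0 \<le> l 0 + m 0"
  using assms mem_LR_semigroup_iff lr_triangle.first_part_le by blast

lemma LR_semigroup_eq_0:
  assumes "(l, m, n) \<in> LR_semigroup r" and "n 0 = 0"
  shows "(l, m, n) = 0"
proof -
  have "n i = 0" for i
    using antimonoD[OF LR_semigroup_antimono(3)[OF assms(1)], of 0 i] assms(2) by simp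
  then show ?thesis
    using LR_semigroup_inner_le[OF assms(1)] LR_semigroup_content_le[OF assms(1)]
    by (simp add: zero_prod_def fun_eq_iff)
qed

lemma LR_semigroup_zero_content:
  assumes "l \<in> partitions r"
  shows "(l, 0, l) \<in> LR_semigroup r"
proof -
  have "lr_triangle r l 0 l 0"
    using assms by unfold_locales (auto simp: subshape_def partitions_def antimonoD)
  then show ?thesis using mem_LR_semigroup_iff by blast
qed

lemma prepend_mem_LR_semigroup_iff:
  "prepend y (l, m, n) \<in> LR_semigroup (r + 3) \<longleftrightarrow> (l, m, n) \<in> LR_semigroup r \<and> n 0 \<le> y"
proof (intro iffI conjI)
  assume mem: "prepend y (l, m, n) \<in> LR_semigroup (r + 3)"
  then show "(l, m, n) \<in> LR_semigroup r"
    unfolding prepend.simps mem_LR_semigroup_iff using lr_triangle_prependD by blast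
  show "n 0 \<le> y"
    using antimonoD[OF LR_semigroup_antimono(3), of "y ## y ## l" "y ## y ## m" "2 * y ## y ## y ## n"
        "r + 3" "Suc (Suc 0)" "Suc (Suc (Suc 0))"] mem by simp
next
  assume "(l, m, n) \<in> LR_semigroup r \<and> n 0 \<le> y"
  then show "prepend y (l, m, n) \<in> LR_semigroup (r + 3)"
    unfolding prepend.simps mem_LR_semigroup_iff using lr_triangle.lr_triangle_prepend by blast
qed

lemma build_add: "(u ## v) + (u' ## v') = (u + u') ## (v + v')"
proof
  show "((u ## v) + (u' ## v')) i = ((u + u') ## (v + v')) i" for i
    by (cases i) simp_all
qed

lemma build_0_0: "0 ## 0 = 0"
proof
  show "(0 ## 0) i = 0 i" for i by (cases i) simp_all
qed

lemma prepend_add: "prepend y x + prepend y' x' = prepend (y + y') (x + x')"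
  by (cases x; cases x') (simp add: build_add)

lemma prepend_eq_iff: "prepend y x = prepend y' x' \<longleftrightarrow> y = y' \<and> x = x'"
  by (cases x; cases x') auto

lemma prepend_eq_0_iff: "prepend y x = 0 \<longleftrightarrow> y = 0 \<and> x = 0"
proof -
  have "prepend 0 0 = 0" by (simp add: zero_prod_def build_0_0)
  then show ?thesis by (metis prepend_eq_iff)
qed

text \<open>
  The prepended parts turn \<open>\<nu>\<^sub>1 \<le> \<lambda>\<^sub>1 + \<mu>\<^sub>1\<close>, \<open>\<lambda>\<^sub>2 \<le> \<nu>\<^sub>2\<close>, \<open>\<mu>\<^sub>2 \<le> \<nu>\<^sub>2\<close>, \<open>\<lambda>\<^sub>2 \<le> \<lambda>\<^sub>1\<close>, \<open>\<mu>\<^sub>2 \<le> \<mu>\<^sub>1\<close> and \<open>\<nu>\<^sub>3 \<le> \<nu>\<^sub>2\<close>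
  into equalities, hence so do both summands.
\<close>

lemma LR_semigroup_summand_prependE:
  assumes p: "p \<in> LR_semigroup (r + 3)" and q: "q \<in> LR_semigroup (r + 3)"
    and sum: "p + q = prepend y x"
  obtains y' x' where "p = prepend y' x'" "x' \<in> LR_semigroup r"
proof -
  obtain l m n where p_eq: "p = (l, m, n)" by (metis prod_cases3)
  obtain l' m' n' where q_eq: "q = (l', m', n')" by (metis prod_cases3)
  obtain lx mx nx where x: "x = (lx, mx, nx)" by (metis prod_cases3)
  have "l + l' = y ## y ## lx" "m + m' = y ## y ## mx" "n + n' = 2 * y ## y ## y ## nx"
    using sum by (simp_all add: p_eq q_eq x)
  then have sums: "l i + l' i = (y ## y ## lx) i" "m i + m' i = (y ## y ## mx) i"
    "n i + n' i = (2 * y ## y ## y ## nx) i" for i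
    by (metis plus_fun_apply)+
  have valid: "a 1 \<le> a 0" "b 1 \<le> b 0" "c 2 \<le> c 1" "c 0 \<le> a 0 + b 0" "a 1 \<le> c 1" "b 1 \<le> c 1"
    if "(a, b, c) \<in> LR_semigroup (r + 3)" for a b c
    using LR_semigroup_antimono[OF that] LR_semigroup_inner_le[OF that]
      LR_semigroup_content_le[OF that] LR_semigroup_first_part_le[OF that]
    by (simp_all add: antimonoD)
  have tight: "l 0 = n 1" "l 1 = n 1" "m 0 = n 1" "m 1 = n 1" "n 0 = 2 * n 1" "n 2 = n 1"
    using valid[OF p[unfolded p_eq]] valid[OF q[unfolded q_eq]]
      sums(1)[of 0] sums(1)[of 1] sums(2)[of 0] sums(2)[of 1] sums(3)[of 0] sums(3)[of 1] sums(3)[of 2]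
    by (simp_all add: numeral_2_eq_2)
  have split: "w = w 0 ## w 1 ## suffix 2 w" "w = w 0 ## w 1 ## w 2 ## suffix 3 w" for w :: "nat \<Rightarrow> nat"
    by (simp_all add: numeral_2_eq_2 numeral_3_eq_3)
  have "p = prepend (n 1) (suffix 2 l, suffix 2 m, suffix 3 n)"
    using split(1)[of l] split(1)[of m] split(2)[of n] unfolding p_eq prepend.simps tight by simp
  moreover from this p have "(suffix 2 l, suffix 2 m, suffix 3 n) \<in> LR_semigroup r"
    using prepend_mem_LR_semigroup_iff by metis
  ultimately show thesis by (rule that)
qed

subsection \<open>Hilbert basis elements with large first part\<close>

lemma mem_hilbert_basis_iff:
  "x \<in> hilbert_basis S \<longleftrightarrow>
     x \<in> S \<and> x \<noteq> 0 \<and> (\<forall>p\<in>S. \<forall>q\<in>S. p + q = x \<longrightarrow> p = 0 \<or> q = 0)"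
  unfolding hilbert_basis_def by blast

lemma prepend_mem_hilbert_basis:
  assumes "(l, m, n) \<in> hilbert_basis (LR_semigroup r)"
  shows "prepend (n 0) (l, m, n) \<in> hilbert_basis (LR_semigroup (r + 3))"
proof -
  have x: "(l, m, n) \<in> LR_semigroup r" "(l, m, n) \<noteq> 0"
    and irreducible: "\<forall>p\<in>LR_semigroup r. \<forall>q\<in>LR_semigroup r. p + q = (l, m, n) \<longrightarrow> p = 0 \<or> q = 0"
    using assms unfolding mem_hilbert_basis_iff by simp_all
  have "p = 0 \<or> q = 0"
    if p: "p \<in> LR_semigroup (r + 3)" and q: "q \<in> LR_semigroup (r + 3)"
      and sum: "p + q = prepend (n 0) (l, m, n)" for p q
  proof -
    obtain y l1 m1 n1 where p_eq: "p = prepend y (l1, m1, n1)" and p': "(l1, m1, n1) \<in> LR_semigroup r"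
      using LR_semigroup_summand_prependE[OF p q sum] by (metis prod_cases3)
    obtain z l2 m2 n2 where q_eq: "q = prepend z (l2, m2, n2)" and q': "(l2, m2, n2) \<in> LR_semigroup r"
      using LR_semigroup_summand_prependE[OF q p] sum by (metis prod_cases3 add.commute)
    have "y + z = n 0" and decomposition: "(l1, m1, n1) + (l2, m2, n2) = (l, m, n)"
      using sum unfolding p_eq q_eq prepend_add prepend_eq_iff by simp_all
    moreover have "n1 0 \<le> y" "n2 0 \<le> z"
      using p q unfolding p_eq q_eq prepend_mem_LR_semigroup_iff by simp_all
    ultimately have "n1 0 = y" "n2 0 = z" by auto
    moreover have "(l1, m1, n1) = 0 \<or> (l2, m2, n2) = 0"
      using irreducible p' q' decomposition by blast
    ultimately show ?thesis
      unfolding p_eq q_eq prepend_eq_0_iff by (auto simp: zero_prod_def)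
  qed
  moreover have "prepend (n 0) (l, m, n) \<noteq> 0"
    using x(2) unfolding prepend_eq_0_iff by simp
  moreover have "prepend (n 0) (l, m, n) \<in> LR_semigroup (r + 3)"
    using x(1) unfolding prepend_mem_LR_semigroup_iff by simp
  ultimately show ?thesis unfolding mem_hilbert_basis_iff by metis
qed

lemma LR_semigroup_first_part_1_mem_hilbert_basis:
  assumes x: "(l, m, n) \<in> LR_semigroup r" and "n 0 = 1"
  shows "(l, m, n) \<in> hilbert_basis (LR_semigroup r)"
proof -
  have "p = 0 \<or> q = 0"
    if "p \<in> LR_semigroup r" "q \<in> LR_semigroup r" "p + q = (l, m, n)" for p q
  proof -
    obtain l1 m1 n1 l2 m2 n2 where pq: "p = (l1, m1, n1)" "q = (l2, m2, n2)" by (metis prod_cases3)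
    then have "n1 0 = 0 \<or> n2 0 = 0" using that(3) \<open>n 0 = 1\<close> by auto
    then show ?thesis using LR_semigroup_eq_0 that(1,2) unfolding pq by blast
  qed
  moreover have "(l, m, n) \<noteq> 0" using \<open>n 0 = 1\<close> by (auto simp: zero_prod_def)
  ultimately show ?thesis using x unfolding mem_hilbert_basis_iff by blast
qed

lemma hilbert_basis_first_part_power_2:
  "\<exists>l m n. (l, m, n) \<in> hilbert_basis (LR_semigroup (3 * k + 1)) \<and> n 0 = 2 ^ k"
proof (induction k)
  case 0
  have "1 ## 0 \<in> partitions 1"
    by (auto simp: partitions_def antimono_iff_le_Suc gr0_conv_Suc Suc_le_eq split: nat.split)
  then show ?case
    using LR_semigroup_first_part_1_mem_hilbert_basis[OF LR_semigroup_zero_content] by fastforce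
next
  case (Suc k)
  then obtain l m n where "(l, m, n) \<in> hilbert_basis (LR_semigroup (3 * k + 1))" "n 0 = 2 ^ k"
    by blast
  then have "prepend (2 ^ k) (l, m, n) \<in> hilbert_basis (LR_semigroup (3 * k + 1 + 3))"
    using prepend_mem_hilbert_basis by metis
  moreover have "3 * Suc k + 1 = 3 * k + 1 + 3" by simp
  ultimately show ?case by (metis build.simps(1) power_Suc prepend.simps)
qed

lemma exists_affine_less_power_2:
  fixes a b :: real
  shows "\<exists>k. a * real (3 * k + 1) + b < 2 ^ k"
proof -
  have "(\<lambda>k. (3 * a) * (real k * (1 / 2) ^ k) + (a + b) * (1 / 2) ^ k) \<longlonglongrightarrow> (3 * a) * 0 + (a + b) * 0"
    by (intro tendsto_intros powser_times_n_limit_0 LIMSEQ_power_zero) simp_all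
  then have "\<forall>\<^sub>F k in sequentially. (3 * a) * (real k * (1 / 2) ^ k) + (a + b) * (1 / 2) ^ k < 1"
    by (rule order_tendstoD) simp
  then obtain k where less: "(3 * a) * (real k * (1 / 2) ^ k) + (a + b) * (1 / 2) ^ k < 1"
    using eventually_happens sequentially_bot by blast
  have "a * real (3 * k + 1) + b = ((3 * a) * (real k * (1 / 2) ^ k) + (a + b) * (1 / 2) ^ k) * 2 ^ k"
    by (simp add: field_simps)
  also have "\<dots> < 1 * 2 ^ k" using less by (intro mult_strict_right_mono) simp_all
  finally show ?thesis by auto
qed

theorem theoremB1:
  "\<not> (\<exists>a b :: real. \<forall>r::nat. r \<ge> 1 \<longrightarrow>
        (\<forall>(l, m, n) \<in> hilbert_basis (LR_semigroup r). real (n 0) \<le> a * real r + b))"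
proof
  assume "\<exists>a b :: real. \<forall>r::nat. r \<ge> 1 \<longrightarrow>
        (\<forall>(l, m, n) \<in> hilbert_basis (LR_semigroup r). real (n 0) \<le> a * real r + b)"
  then obtain a b :: real where bound: "\<And>r l m n. 1 \<le> r \<Longrightarrow>
      (l, m, n) \<in> hilbert_basis (LR_semigroup r) \<Longrightarrow> real (n 0) \<le> a * real r + b"
    by fast
  obtain k where k: "a * real (3 * k + 1) + b < 2 ^ k"
    using exists_affine_less_power_2 by blast
  obtain l m n where "(l, m, n) \<in> hilbert_basis (LR_semigroup (3 * k + 1))" "n 0 = 2 ^ k"
    using hilbert_basis_first_part_power_2 by blast
  then have "2 ^ k \<le> a * real (3 * k + 1) + b"
    using bound[of "3 * k + 1" l m n] by simp
  with k show False by simp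
qed

end
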